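(* Let $\mathbf{x}_1,\dots,\mathbf{x}_n\in\mathbb{R}^d$ be independent centered subgaussian random vectors with $\|\mathbf{x}_i\|_{\psi_2}\le L$ for all $i$, where $L$ is a constant. Let $a,b\in\mathbb{R}$, let $p\in\mathbb{N}$, and let $K_p$ be the $n\times n$ matrix with $(i,j)$th entry $(a\langle \mathbf{x}_i,\mathbf{x}_j\rangle+b)^p$. Assume that $n\le \exp(C_1 d)$ for a constant $C_1$. Then there exist constants $C_0, C_0'$ such that $$\Pr\left[\|K_p\|\ \ge\ C_0^p|a|^p d^p n+2^{p+1}|b|^p n\right]\ \le\ \exp(-C_0' d).$$
   Context: Constants are positive numbers independent of $n$ and $d$; $C_0, C_0'$ may depend on the subgaussian constant $L$ and on $C_1$. The vectors need not be identically distributed. $\|M\|$ denotes the spectral (operator) norm of a matrix $M$, and $\langle\cdot,\cdot\rangle$ is the Euclidean inner product. For a real random variable $x$, $\|x\|_{\psi_2}=\inf\{t>0:\mathbb{E}[\exp(|x|^2/t^2)]\le 2\}$. For a random vector $\mathbf{x}\in\mathbb{R}^d$, $\|\mathbf{x}\|_{\psi_2}=\sup_{\mathbf{y}\in S^{d-1}}\|\langle \mathbf{x},\mathbf{y}\rangle\|_{\psi_2}$, where $S^{d-1}$ is the Euclidean unit sphere; $\mathbf{x}$ is subgaussian if all one-dimensional marginals $\langle\mathbf{x},\mathbf{y}\rangle$ are subgaussian, i.e. have finite $\psi_2$-norm. A random vector is centered if $\mathbb{E}[\mathbf{x}]=0$.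
   Formalization: The case a = b = 0 with p ≥ 1 is excluded (there K_p = 0 and the threshold is 0, so the event has probability 1 and the claim fails); the constants are stated for probability measures on an arbitrary fixed sample space. *)

theory Defs
  imports "HOL-Probability.Probability"
begin

text \<open>
  The dimension \<open>d\<close> is quantified inside the theorem (the constants must not depend on it), so
  \<open>\<real>\<^sup>d\<close> is modelled by the extensional functions on \<open>{..<d}\<close>; they are exactly the points of the
  product measurable space \<open>borel_vec d\<close>. The Euclidean norm is the library's \<^const>\<open>L2_set\<close>.
\<close>

abbreviation borel_vec :: "nat \<Rightarrow> (nat \<Rightarrow> real) measure" where
  "borel_vec d \<equiv> (\<Pi>\<^sub>M k\<in>{..<d}. borel)"

definition vecs :: "nat \<Rightarrow> (nat \<Rightarrow> real) set" where
  "vecs d = ({..<d} \<rightarrow>\<^sub>E UNIV)"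

definition inner_vec :: "nat \<Rightarrow> (nat \<Rightarrow> real) \<Rightarrow> (nat \<Rightarrow> real) \<Rightarrow> real" where
  "inner_vec d u v = (\<Sum>k<d. u k * v k)"

definition unit_sphere :: "nat \<Rightarrow> (nat \<Rightarrow> real) set" where
  "unit_sphere d = {y \<in> vecs d. L2_set y {..<d} = 1}"

text \<open>
  The \<open>\<psi>\<^sub>2\<close>-norm takes values in \<^typ>\<open>ennreal\<close>: it is \<open>\<infinity>\<close> when no \<open>t\<close> is admissible. The
  expectation is the nonnegative integral, so a divergent one is \<open>\<infinity>\<close> (the Bochner integral would
  return \<open>0\<close> and make such a \<open>t\<close> admissible).
\<close>

definition psi2_norm :: "'w measure \<Rightarrow> ('w \<Rightarrow> real) \<Rightarrow> ennreal" where
  "psi2_norm M X =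
     Inf (ennreal ` {t. t > 0 \<and> (\<integral>\<^sup>+ \<omega>. ennreal (exp (\<bar>X \<omega>\<bar>\<^sup>2 / t\<^sup>2)) \<partial>M) \<le> 2})"

definition psi2_norm_vec :: "'w measure \<Rightarrow> nat \<Rightarrow> ('w \<Rightarrow> nat \<Rightarrow> real) \<Rightarrow> ennreal" where
  "psi2_norm_vec M d X = (SUP y\<in>unit_sphere d. psi2_norm M (\<lambda>\<omega>. inner_vec d (X \<omega>) y))"

definition subgaussian_vec :: "'w measure \<Rightarrow> nat \<Rightarrow> ('w \<Rightarrow> nat \<Rightarrow> real) \<Rightarrow> bool" where
  "subgaussian_vec M d X \<longleftrightarrow>
     (\<forall>y\<in>vecs d. psi2_norm M (\<lambda>\<omega>. inner_vec d (X \<omega>) y) < \<infinity>)"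

definition centered_vec :: "'w measure \<Rightarrow> nat \<Rightarrow> ('w \<Rightarrow> nat \<Rightarrow> real) \<Rightarrow> bool" where
  "centered_vec M d X \<longleftrightarrow>
     (\<forall>k<d. integrable M (\<lambda>\<omega>. X \<omega> k) \<and> (\<integral>\<omega>. X \<omega> k \<partial>M) = 0)"

definition spectral_norm :: "nat \<Rightarrow> (nat \<Rightarrow> nat \<Rightarrow> real) \<Rightarrow> real" where
  "spectral_norm n A =
     (SUP v\<in>unit_sphere n. L2_set (\<lambda>i. \<Sum>j<n. A i j * v j) {..<n})"

definition poly_kernel_matrix ::
    "nat \<Rightarrow> real \<Rightarrow> real \<Rightarrow> nat \<Rightarrow> (nat \<Rightarrow> nat \<Rightarrow> real) \<Rightarrow> nat \<Rightarrow> nat \<Rightarrow> real" where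
  "poly_kernel_matrix d a b p x i j = (a * inner_vec d (x i) (x j) + b) ^ p"

end

theory Submission
  imports Defs
begin

text \<open>
  The spectral norm is at most \<open>n\<close> times the largest entry, and Cauchy--Schwarz bounds the entries
  in terms of the Euclidean norms of the vectors, so it suffices that all of them satisfy
  \<open>\<parallel>x\<^sub>i\<parallel>\<^sup>2 < K d\<close>. For this the square is linearised with a standard Gaussian vector \<open>g\<close>:
  \<open>exp (s\<^sup>2 \<parallel>x\<parallel>\<^sup>2 / 2) = E\<^sub>g exp (s \<langle>x, g\<rangle>)\<close>. Exchanging the two expectations and using the
  \<open>\<psi>\<^sub>2\<close>-bound in the direction of \<open>g\<close> gives \<open>E exp (\<parallel>x\<parallel>\<^sup>2 / (8 L\<^sup>2)) \<le> 2 \<cdot> 2\<^sup>d\<close>, without any net on the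
  sphere. Markov's inequality and a union bound over \<open>n \<le> exp (C\<^sub>1 d)\<close> vectors conclude.
\<close>

section \<open>Exponential moments of one-dimensional marginals\<close>

text \<open>The infimum in \<open>psi2_norm\<close> is not shown to be attained, hence the strict
  \<open>L < t\<close>: some admissible \<open>u\<close> lies below \<open>t\<close>, and the
  integrand decreases in the parameter.\<close>

lemma nn_integral_exp_square_le_of_psi2_norm:
  assumes "psi2_norm M X \<le> ennreal L" and "L > 0" and "L < t"
  shows "(\<integral>\<^sup>+\<omega>. ennreal (exp ((X \<omega>)\<^sup>2 / t\<^sup>2)) \<partial>M) \<le> 2"
proof -
  have "psi2_norm M X < ennreal t"
    using assms by (simp add: order.strict_trans1 ennreal_lessI)
  then obtain u where u: "u > 0" "(\<integral>\<^sup>+\<omega>. ennreal (exp (\<bar>X \<omega>\<bar>\<^sup>2 / u\<^sup>2)) \<partial>M) \<le> 2" "ennreal u < ennreal t"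
    unfolding psi2_norm_def by (auto simp: Inf_less_iff)
  then have "u < t"
    using assms by (simp add: ennreal_less_iff)
  then have "exp ((X \<omega>)\<^sup>2 / t\<^sup>2) \<le> exp (\<bar>X \<omega>\<bar>\<^sup>2 / u\<^sup>2)" for \<omega>
    using u(1) by (auto intro!: divide_left_mono power_mono mult_pos_pos)
  then show ?thesis
    by (intro order.trans[OF nn_integral_mono u(2)]) (simp add: ennreal_leI)
qed

text \<open>Write \<open>g\<close> as its length \<open>r\<close> times a unit vector
  \<open>u\<close> and apply the marginal bound to \<open>u\<close> at scale \<open>2 * L\<close>.
  For \<open>g = 0\<close> there is no direction, but the left side is then 1.\<close>

lemma nn_integral_exp_inner_vec_le:
  assumes "psi2_norm_vec M d X \<le> ennreal L" and "L > 0" and "prob_space M"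
    and [measurable]: "X \<in> M \<rightarrow>\<^sub>M borel_vec d"
  shows "(\<integral>\<^sup>+\<omega>. ennreal (exp (inner_vec d (X \<omega>) g / (2 * L))) \<partial>M)
           \<le> 2 * ennreal (exp ((L2_set g {..<d})\<^sup>2 / 4))"
proof (cases "L2_set g {..<d} = 0")
  case True
  then have "inner_vec d v g = 0" for v
    by (simp add: L2_set_eq_0_iff inner_vec_def)
  then show ?thesis
    using True prob_space.emeasure_space_1[OF assms(3)] by simp
next
  case False
  define r where "r = L2_set g {..<d}"
  have r: "r > 0"
    using False by (simp add: r_def less_le)
  \<comment> \<open>\<open>restrict\<close> is there because \<open>unit_sphere\<close> contains
    only extensional functions.\<close>
  define u where "u = restrict (\<lambda>k. g k / r) {..<d}"
  have "L2_set u {..<d} = L2_set (\<lambda>k. (1 / r) * g k) {..<d}"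
    by (rule L2_set_cong) (auto simp: u_def)
  also have "\<dots> = 1"
    using r by (subst L2_set_right_distrib[symmetric]) (auto simp: r_def[symmetric])
  finally have "u \<in> unit_sphere d"
    by (simp add: unit_sphere_def vecs_def u_def)
  then have "psi2_norm M (\<lambda>\<omega>. inner_vec d (X \<omega>) u) \<le> ennreal L"
    using assms(1) by (auto simp: psi2_norm_vec_def SUP_le_iff)
  then have *: "(\<integral>\<^sup>+\<omega>. ennreal (exp ((inner_vec d (X \<omega>) u)\<^sup>2 / (2 * L)\<^sup>2)) \<partial>M) \<le> 2"
    using assms(2) by (rule nn_integral_exp_square_le_of_psi2_norm) (use assms(2) in simp)
  \<comment> \<open>Young's inequality separates \<open>r\<close> from the random factor. The
    coefficient 1/4 stays below the 1/2 of the Gaussian exponent, so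
    \<open>exp (r\<^sup>2 / 4)\<close> is Gaussian integrable.\<close>
  have "inner_vec d v g / (2 * L) \<le> r\<^sup>2 / 4 + (inner_vec d v u)\<^sup>2 / (2 * L)\<^sup>2" for v
  proof -
    have g: "inner_vec d v g = r * inner_vec d v u"
      using r by (simp add: inner_vec_def u_def sum_distrib_left)
    have "r\<^sup>2 / 4 + (inner_vec d v u)\<^sup>2 / (2 * L)\<^sup>2 - inner_vec d v g / (2 * L)
        = (r / 2 - inner_vec d v u / (2 * L))\<^sup>2"
      by (simp add: g power2_diff power_divide)
    then show ?thesis
      by (metis diff_ge_0_iff_ge zero_le_power2)
  qed
  then have "exp (inner_vec d v g / (2 * L)) \<le> exp (r\<^sup>2 / 4) * exp ((inner_vec d v u)\<^sup>2 / (2 * L)\<^sup>2)" for v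
    by (simp flip: exp_add)
  then have "(\<integral>\<^sup>+\<omega>. ennreal (exp (inner_vec d (X \<omega>) g / (2 * L))) \<partial>M)
      \<le> (\<integral>\<^sup>+\<omega>. ennreal (exp (r\<^sup>2 / 4)) * ennreal (exp ((inner_vec d (X \<omega>) u)\<^sup>2 / (2 * L)\<^sup>2)) \<partial>M)"
    by (intro nn_integral_mono) (simp add: ennreal_leI flip: ennreal_mult)
  also have "\<dots> = ennreal (exp (r\<^sup>2 / 4)) * (\<integral>\<^sup>+\<omega>. ennreal (exp ((inner_vec d (X \<omega>) u)\<^sup>2 / (2 * L)\<^sup>2)) \<partial>M)"
    unfolding inner_vec_def by (rule nn_integral_cmult) measurable
  also have "\<dots> \<le> ennreal (exp (r\<^sup>2 / 4)) * 2"
    by (rule mult_left_mono[OF *]) simp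
  finally show ?thesis
    by (simp add: r_def mult.commute)
qed

section \<open>Gaussian integrals and the tail of the squared norm\<close>

abbreviation std_gaussian :: "real measure" where
  "std_gaussian \<equiv> density lborel (std_normal_density)"

lemma nn_integral_normal_density:
  assumes "\<sigma> > 0"
  shows "(\<integral>\<^sup>+x. ennreal (normal_density \<mu> \<sigma> x) \<partial>lborel) = 1"
  using assms by (simp add: nn_integral_eq_integral integrable_normal_density integral_normal_density)

text \<open>Completing the square leaves a multiple of the normal density with mean
  \<open>t\<close>.\<close>

lemma nn_integral_std_gaussian_exp:
  "(\<integral>\<^sup>+y. ennreal (exp (t * y)) \<partial>std_gaussian) = ennreal (exp (t\<^sup>2 / 2))"
proof -
  have "std_normal_density y * exp (t * y) = exp (t\<^sup>2 / 2) * normal_density t 1 y" for y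
    by (simp add: normal_density_def flip: exp_add) (simp add: power2_eq_square field_simps)
  then have "(\<integral>\<^sup>+y. ennreal (exp (t * y)) \<partial>std_gaussian)
      = (\<integral>\<^sup>+y. ennreal (exp (t\<^sup>2 / 2)) * ennreal (normal_density t 1 y) \<partial>lborel)"
    by (simp add: nn_integral_density flip: ennreal_mult)
  then show ?thesis
    by (simp add: nn_integral_cmult nn_integral_normal_density)
qed

text \<open>The factor halves the Gaussian exponent, which leaves a multiple of the centered density
  of variance 2.\<close>

lemma nn_integral_std_gaussian_exp_square:
  "(\<integral>\<^sup>+y. ennreal (exp (y\<^sup>2 / 4)) \<partial>std_gaussian) = ennreal (sqrt 2)"
proof -
  have "std_normal_density y * exp (y\<^sup>2 / 4) = sqrt 2 * normal_density 0 (sqrt 2) y" for y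
    by (simp add: normal_density_def real_sqrt_mult real_div_sqrt flip: exp_add)
      (simp add: field_simps)
  then have "(\<integral>\<^sup>+y. ennreal (exp (y\<^sup>2 / 4)) \<partial>std_gaussian)
      = (\<integral>\<^sup>+y. ennreal (sqrt 2) * ennreal (normal_density 0 (sqrt 2) y) \<partial>lborel)"
    by (simp add: nn_integral_density flip: ennreal_mult)
  then show ?thesis
    by (simp add: nn_integral_cmult nn_integral_normal_density)
qed

text \<open>The linearisation with scale \<open>1 / (2 * L)\<close> produces the exponent
  \<open>1 / (8 * L\<^sup>2)\<close>; it is proved coordinatewise, since \<open>?G\<close> is a
  product measure.\<close>

lemma nn_integral_exp_norm_square_le:
  assumes "psi2_norm_vec M d X \<le> ennreal L" and "L > 0" and "prob_space M"
    and [measurable]: "X \<in> M \<rightarrow>\<^sub>M borel_vec d"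
  shows "(\<integral>\<^sup>+\<omega>. ennreal (exp ((L2_set (X \<omega>) {..<d})\<^sup>2 / (8 * L\<^sup>2))) \<partial>M) \<le> ennreal (2 * 2 ^ d)"
proof -
  interpret prob_space M by fact
  let ?G = "\<Pi>\<^sub>M k\<in>{..<d}. std_gaussian"
  interpret P: product_prob_space "\<lambda>_. std_gaussian" "{..<d}"
    by (intro product_prob_spaceI prob_space_normal_density) simp
  interpret pair_sigma_finite M ?G
    by standard
  have sq: "(L2_set v {..<d})\<^sup>2 = (\<Sum>k<d. (v k)\<^sup>2)" for v
    by (simp add: L2_set_def sum_nonneg)
  have "ennreal (exp ((L2_set v {..<d})\<^sup>2 / (8 * L\<^sup>2)))
      = (\<integral>\<^sup>+g. ennreal (exp (inner_vec d v g / (2 * L))) \<partial>?G)" for v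
  proof -
    have "ennreal (exp ((L2_set v {..<d})\<^sup>2 / (8 * L\<^sup>2))) = (\<Prod>k<d. ennreal (exp ((v k / (2 * L))\<^sup>2 / 2)))"
      by (simp add: sq sum_divide_distrib exp_sum prod_ennreal power_divide power_mult_distrib)
    also have "\<dots> = (\<integral>\<^sup>+g. (\<Prod>k<d. ennreal (exp (v k / (2 * L) * g k))) \<partial>?G)"
      by (simp only: nn_integral_std_gaussian_exp[symmetric]) (subst P.product_nn_integral_prod; simp)
    also have "\<dots> = (\<integral>\<^sup>+g. ennreal (exp (inner_vec d v g / (2 * L))) \<partial>?G)"
      by (simp add: inner_vec_def sum_divide_distrib exp_sum prod_ennreal)
    finally show ?thesis .
  qed
  then have "(\<integral>\<^sup>+\<omega>. ennreal (exp ((L2_set (X \<omega>) {..<d})\<^sup>2 / (8 * L\<^sup>2))) \<partial>M)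
      = (\<integral>\<^sup>+\<omega>. (\<integral>\<^sup>+g. ennreal (exp (inner_vec d (X \<omega>) g / (2 * L))) \<partial>?G) \<partial>M)"
    by simp
  also have "\<dots> = (\<integral>\<^sup>+g. (\<integral>\<^sup>+\<omega>. ennreal (exp (inner_vec d (X \<omega>) g / (2 * L))) \<partial>M) \<partial>?G)"
    unfolding inner_vec_def by (rule Fubini'[symmetric]) measurable
  also have "\<dots> \<le> (\<integral>\<^sup>+g. 2 * ennreal (exp ((L2_set g {..<d})\<^sup>2 / 4)) \<partial>?G)"
    using assms by (intro nn_integral_mono nn_integral_exp_inner_vec_le)
  also have "\<dots> = (\<integral>\<^sup>+g. 2 * (\<Prod>k<d. ennreal (exp ((g k)\<^sup>2 / 4))) \<partial>?G)"
    by (simp add: sq sum_divide_distrib exp_sum prod_ennreal)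
  also have "\<dots> = 2 * (\<integral>\<^sup>+g. (\<Prod>k<d. ennreal (exp ((g k)\<^sup>2 / 4))) \<partial>?G)"
    by (rule nn_integral_cmult) measurable
  also have "\<dots> = 2 * ennreal (sqrt 2) ^ d"
    by (subst P.product_nn_integral_prod) (auto simp: nn_integral_std_gaussian_exp_square)
  \<comment> \<open>Crude rounding of \<open>sqrt 2\<close> to 2; only exponential growth in
    \<open>d\<close> matters later.\<close>
  also have "\<dots> \<le> 2 * ennreal 2 ^ d"
    by (intro mult_left_mono power_mono ennreal_leI) (auto simp: real_le_lsqrt)
  also have "\<dots> = ennreal (2 * 2 ^ d)"
    by (simp add: ennreal_mult flip: ennreal_power)
  finally show ?thesis .
qed

text \<open>Markov's inequality at level \<open>exp (c * real d)\<close>; the 2 in the exponent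
  absorbs the moment bound \<open>2 * 2 ^ d\<close>.\<close>

lemma (in prob_space) prob_norm_square_ge_le:
  assumes "psi2_norm_vec M d X \<le> ennreal L" and "L > 0" and "d \<ge> 1"
    and [measurable]: "X \<in> M \<rightarrow>\<^sub>M borel_vec d"
  shows "prob {\<omega> \<in> space M. (L2_set (X \<omega>) {..<d})\<^sup>2 \<ge> 8 * L\<^sup>2 * c * real d} \<le> exp ((2 - c) * real d)"
proof -
  let ?f = "\<lambda>\<omega>. (L2_set (X \<omega>) {..<d})\<^sup>2 / (8 * L\<^sup>2)"
  have meas: "(\<lambda>\<omega>. L2_set (X \<omega>) {..<d}) \<in> borel_measurable M"
    unfolding L2_set_def by measurable
  have eq: "{\<omega> \<in> space M. (L2_set (X \<omega>) {..<d})\<^sup>2 \<ge> 8 * L\<^sup>2 * c * real d}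
      = {\<omega> \<in> space M. 1 \<le> ennreal (exp (- c * real d)) * ennreal (exp (?f \<omega>))}"
    using \<open>L > 0\<close> by (auto simp: field_simps simp flip: ennreal_mult exp_add ennreal_1)
  have "emeasure M {\<omega> \<in> space M. (L2_set (X \<omega>) {..<d})\<^sup>2 \<ge> 8 * L\<^sup>2 * c * real d}
      \<le> ennreal (exp (- c * real d)) * (\<integral>\<^sup>+\<omega>. ennreal (exp (?f \<omega>)) \<partial>M)"
    unfolding eq
    using nn_integral_Markov_inequality[of "\<lambda>\<omega>. ennreal (exp (?f \<omega>))" "space M" M "ennreal (exp (- c * real d))"]
      meas by (simp cong: nn_integral_cong)
  also have "\<dots> \<le> ennreal (exp (- c * real d)) * ennreal (2 * 2 ^ d)"
    by (intro mult_left_mono nn_integral_exp_norm_square_le) (use assms prob_space_axioms in auto)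
  also have "\<dots> = ennreal (exp (- c * real d) * (2 * 2 ^ d))"
    by (simp add: ennreal_mult)
  finally have "prob {\<omega> \<in> space M. (L2_set (X \<omega>) {..<d})\<^sup>2 \<ge> 8 * L\<^sup>2 * c * real d}
      \<le> exp (- c * real d) * (2 * 2 ^ d)"
    by (simp add: emeasure_eq_measure)
  also have "\<dots> \<le> exp (- c * real d) * exp (2 * real d)"
  proof (rule mult_left_mono)
    have e: "(2::real) \<le> exp 1"
      using exp_ge_add_one_self[of 1] by simp
    \<comment> \<open>As \<open>d \<ge> 1\<close>, the leading factor 2 fits into a second
      \<open>2 ^ d\<close>.\<close>
    have "(2::real) * 2 ^ d \<le> 2 ^ d * 2 ^ d"
      using \<open>d \<ge> 1\<close> by (simp add: self_le_power)
    also have "\<dots> \<le> exp 1 ^ d * exp 1 ^ d"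
      using e by (intro mult_mono power_mono) auto
    also have "\<dots> = exp (2 * real d)"
      by (simp flip: exp_of_nat_mult exp_add)
    finally show "(2::real) * 2 ^ d \<le> exp (2 * real d)" .
  qed simp
  also have "\<dots> = exp ((2 - c) * real d)"
    by (simp add: algebra_simps flip: exp_add)
  finally show ?thesis .
qed

section \<open>Deterministic bounds on the spectral norm\<close>

text \<open>Needed because a real supremum can be bounded through \<open>cSUP_least\<close> only
  over a nonempty set.\<close>

lemma unit_sphere_nonempty:
  assumes "n \<ge> 1"
  shows "unit_sphere n \<noteq> {}"
proof -
  let ?e = "restrict (\<lambda>i. if i = 0 then 1 else 0) {..<n} :: nat \<Rightarrow> real"
  have "L2_set ?e {..<n} = L2_set (\<lambda>i. if i = 0 then 1 else 0) {..<n}"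
    by (rule L2_set_cong) auto
  also have "\<dots> = 1"
    using assms by (simp add: L2_set_def if_distrib[of "\<lambda>x. x\<^sup>2"] cong: if_cong)
  finally have "?e \<in> unit_sphere n"
    by (simp add: unit_sphere_def vecs_def)
  then show ?thesis
    by blast
qed

text \<open>Cauchy--Schwarz against the all-ones vector gives each row a factor
  \<open>sqrt n\<close>; the Euclidean norm over the \<open>n\<close> rows gives another.\<close>

lemma spectral_norm_le:
  assumes "n \<ge> 1" and "\<And>i j. i < n \<Longrightarrow> j < n \<Longrightarrow> \<bar>A i j\<bar> \<le> B"
  shows "spectral_norm n A \<le> B * real n"
  unfolding spectral_norm_def
proof (rule cSUP_least[OF unit_sphere_nonempty[OF assms(1)]])
  fix v assume v: "v \<in> unit_sphere n"
  have B: "B \<ge> 0"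
    using assms(2)[of 0 0] assms(1) by linarith
  have "(\<Sum>j<n. \<bar>v j\<bar>) \<le> L2_set (\<lambda>_. 1) {..<n} * L2_set v {..<n}"
    using L2_set_mult_ineq[of "\<lambda>_. 1" v "{..<n}"] by simp
  then have v1: "(\<Sum>j<n. \<bar>v j\<bar>) \<le> sqrt (real n)"
    using v by (simp add: unit_sphere_def L2_set_def)
  have row: "\<bar>\<Sum>j<n. A i j * v j\<bar> \<le> B * sqrt (real n)" if "i < n" for i
  proof -
    have "\<bar>\<Sum>j<n. A i j * v j\<bar> \<le> (\<Sum>j<n. B * \<bar>v j\<bar>)"
      by (rule order.trans[OF sum_abs sum_mono])
        (use assms(2) that in \<open>auto simp: abs_mult intro!: mult_right_mono\<close>)
    also have "\<dots> \<le> B * sqrt (real n)"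
      using v1 B by (simp add: mult_left_mono flip: sum_distrib_left)
    finally show ?thesis .
  qed
  have "L2_set (\<lambda>i. \<Sum>j<n. A i j * v j) {..<n} = L2_set (\<lambda>i. \<bar>\<Sum>j<n. A i j * v j\<bar>) {..<n}"
    by (simp add: L2_set_def)
  also have "\<dots> \<le> L2_set (\<lambda>_. B * sqrt (real n)) {..<n}"
    by (rule L2_set_mono) (use row in auto)
  also have "\<dots> = B * real n"
    using B by (simp add: L2_set_def real_sqrt_mult power_mult_distrib)
  finally show "L2_set (\<lambda>i. \<Sum>j<n. A i j * v j) {..<n} \<le> B * real n" .
qed

lemma abs_inner_vec_le: "\<bar>inner_vec d u v\<bar> \<le> L2_set u {..<d} * L2_set v {..<d}"
  unfolding inner_vec_def
  by (rule order.trans[OF sum_abs]) (simp add: abs_mult L2_set_mult_ineq)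

lemma power_add_le_two_power:
  fixes s t :: real
  assumes "s \<ge> 0" and "t \<ge> 0"
  shows "(s + t) ^ p \<le> 2 ^ p * (s ^ p + t ^ p)"
proof -
  have "(s + t) ^ p \<le> (2 * max s t) ^ p"
    using assms by (intro power_mono) auto
  also have "\<dots> \<le> 2 ^ p * (s ^ p + t ^ p)"
    using assms by (auto simp: power_mult_distrib max_def)
  finally show ?thesis .
qed

text \<open>The inequality must be strict, because the event in the theorem is stated with
  \<open>\<ge>\<close>. In \<open>4 * K\<close> one factor 2 comes from
  \<open>power_add_le_two_power\<close>, the other creates the slack.\<close>

lemma spectral_norm_poly_kernel_matrix_less:
  assumes "n \<ge> 1" and "d \<ge> 1" and "K > 0" and "a \<noteq> 0 \<or> b \<noteq> 0 \<or> p = 0"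
    and x: "\<And>i. i < n \<Longrightarrow> (L2_set (x i) {..<d})\<^sup>2 \<le> K * real d"
  shows "spectral_norm n (poly_kernel_matrix d a b p x)
           < (4 * K) ^ p * \<bar>a\<bar> ^ p * real d ^ p * real n + 2 ^ (p + 1) * \<bar>b\<bar> ^ p * real n"
proof -
  let ?s = "\<bar>a\<bar> * (K * real d)"
  let ?B = "2 ^ p * (?s ^ p + \<bar>b\<bar> ^ p)"
  have "\<bar>poly_kernel_matrix d a b p x i j\<bar> \<le> ?B" if "i < n" "j < n" for i j
  proof -
    have le: "L2_set (x k) {..<d} \<le> sqrt (K * real d)" if "k < n" for k
      using x[OF that] by (rule real_le_rsqrt)
    have "\<bar>inner_vec d (x i) (x j)\<bar> \<le> sqrt (K * real d) * sqrt (K * real d)"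
      by (rule order.trans[OF abs_inner_vec_le mult_mono]) (use le that \<open>K > 0\<close> in auto)
    then have "\<bar>a * inner_vec d (x i) (x j)\<bar> \<le> ?s"
      using \<open>K > 0\<close> by (simp add: abs_mult mult_left_mono)
    then have "\<bar>a * inner_vec d (x i) (x j) + b\<bar> \<le> ?s + \<bar>b\<bar>"
      by linarith
    then have "\<bar>poly_kernel_matrix d a b p x i j\<bar> \<le> (?s + \<bar>b\<bar>) ^ p"
      by (simp add: poly_kernel_matrix_def power_abs power_mono)
    also have "\<dots> \<le> ?B"
      by (rule power_add_le_two_power) (use \<open>K > 0\<close> in auto)
    finally show ?thesis .
  qed
  then have "spectral_norm n (poly_kernel_matrix d a b p x) \<le> ?B * real n"
    using assms(1) by (rule spectral_norm_le[rotated])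
  also have "?B < (4 * K) ^ p * \<bar>a\<bar> ^ p * real d ^ p + 2 ^ (p + 1) * \<bar>b\<bar> ^ p"
  \<comment> \<open>For \<open>p > 0\<close> each summand gains a factor of at least 2 and one of
    them is positive. For \<open>p = 0\<close> all powers are 1 and the claim is 2 < 3.\<close>
  proof (cases "p = 0")
    case False
    have four: "(4 * K) ^ p * \<bar>a\<bar> ^ p * real d ^ p = 2 ^ p * (2 ^ p * ?s ^ p)"
      by (simp only: flip: power_mult_distrib) (rule arg_cong[where f = "\<lambda>z. z ^ p"], simp)
    have "?s ^ p > 0 \<or> \<bar>b\<bar> ^ p > 0"
      using assms False by auto
    moreover have "?s ^ p \<ge> 0" "\<bar>b\<bar> ^ p \<ge> 0"
      using \<open>K > 0\<close> by auto
    moreover have "2 * ?s ^ p \<le> 2 ^ p * ?s ^ p"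
      using False \<open>K > 0\<close> by (intro mult_right_mono) (auto simp: self_le_power)
    ultimately have "?s ^ p + \<bar>b\<bar> ^ p < 2 ^ p * ?s ^ p + 2 * \<bar>b\<bar> ^ p"
      by linarith
    then have "2 ^ p * (?s ^ p + \<bar>b\<bar> ^ p) < 2 ^ p * (2 ^ p * ?s ^ p + 2 * \<bar>b\<bar> ^ p)"
      by simp
    then show ?thesis
      unfolding four by (simp add: algebra_simps)
  qed simp
  finally show ?thesis
    using assms(1) by (simp add: distrib_right)
qed

section \<open>Union bound\<close>

text \<open>The condition on \<open>a\<close>, \<open>b\<close>, \<open>p\<close> excludes
  \<open>a = b = 0\<close> with \<open>p > 0\<close>: there the matrix and the threshold both
  vanish, so the event has probability 1.\<close>

theorem theorem3p2:
  fixes L C1 :: real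
  assumes "L > 0" and "C1 > 0"
  shows "\<exists>C0 > 0. \<exists>C0' > 0.
    \<forall>(M :: 'w measure) (n :: nat) (d :: nat) (x :: nat \<Rightarrow> 'w \<Rightarrow> nat \<Rightarrow> real)
      (a :: real) (b :: real) (p :: nat).
      prob_space M \<longrightarrow> n \<ge> 1 \<longrightarrow> d \<ge> 1 \<longrightarrow>
      prob_space.indep_vars M (\<lambda>_. borel_vec d) x {..<n} \<longrightarrow>
      (\<forall>i<n. centered_vec M d (x i)) \<longrightarrow>
      (\<forall>i<n. subgaussian_vec M d (x i)) \<longrightarrow>
      (\<forall>i<n. psi2_norm_vec M d (x i) \<le> ennreal L) \<longrightarrow>
      (a \<noteq> 0 \<or> b \<noteq> 0 \<or> p = 0) \<longrightarrow>
      real n \<le> exp (C1 * real d) \<longrightarrow>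
      measure M {\<omega> \<in> space M.
          spectral_norm n (poly_kernel_matrix d a b p (\<lambda>i. x i \<omega>))
            \<ge> C0 ^ p * \<bar>a\<bar> ^ p * real d ^ p * real n + 2 ^ (p + 1) * \<bar>b\<bar> ^ p * real n}
        \<le> exp (- C0' * real d)"
proof (intro exI conjI allI impI)
  \<comment> \<open>Taking \<open>c = C1 + 3\<close> in \<open>prob_norm_square_ge_le\<close> makes
    the union bound \<open>exp (C1 * d) * exp ((2 - c) * d) = exp (- d)\<close>, so the witnesses
    are \<open>4 * ?K\<close> and 1.\<close>
  let ?K = "8 * L\<^sup>2 * (C1 + 3)"
  show K: "4 * ?K > 0"
    using assms by simp
  show "(1::real) > 0"
    by simp
  fix M :: "'w measure" and n d p :: nat and x :: "nat \<Rightarrow> 'w \<Rightarrow> nat \<Rightarrow> real" and a b :: real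
  assume M: "prob_space M" and n: "n \<ge> 1" and d: "d \<ge> 1"
    and indep: "prob_space.indep_vars M (\<lambda>_. borel_vec d) x {..<n}"
    and psi2: "\<forall>i<n. psi2_norm_vec M d (x i) \<le> ennreal L"
    and nz: "a \<noteq> 0 \<or> b \<noteq> 0 \<or> p = 0" and n_le: "real n \<le> exp (C1 * real d)"
  interpret prob_space M by fact
  have x[measurable]: "x i \<in> M \<rightarrow>\<^sub>M borel_vec d" if "i < n" for i
    using indep that by (simp add: indep_vars_def)
  define E where "E i = {\<omega> \<in> space M. (L2_set (x i \<omega>) {..<d})\<^sup>2 \<ge> ?K * real d}" for i
  have E: "E i \<in> sets M" if "i < n" for i
    unfolding E_def L2_set_def using x[OF that] by measurable
  let ?thr = "(4 * ?K) ^ p * \<bar>a\<bar> ^ p * real d ^ p * real n + 2 ^ (p + 1) * \<bar>b\<bar> ^ p * real n"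
  \<comment> \<open>Covering by the events \<open>E i\<close> suffices: monotonicity of the measure
    asks only the covering set to be measurable.\<close>
  have "{\<omega> \<in> space M. spectral_norm n (poly_kernel_matrix d a b p (\<lambda>i. x i \<omega>)) \<ge> ?thr} \<subseteq> (\<Union>i<n. E i)"
  proof (rule subsetI, rule ccontr)
    fix \<omega>
    assume \<omega>: "\<omega> \<in> {\<omega> \<in> space M. spectral_norm n (poly_kernel_matrix d a b p (\<lambda>i. x i \<omega>)) \<ge> ?thr}"
      and "\<omega> \<notin> (\<Union>i<n. E i)"
    then have "(L2_set (x i \<omega>) {..<d})\<^sup>2 \<le> ?K * real d" if "i < n" for i
      using that by (force simp: E_def)
    then have "spectral_norm n (poly_kernel_matrix d a b p (\<lambda>i. x i \<omega>)) < ?thr"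
      using n d nz K by (intro spectral_norm_poly_kernel_matrix_less) auto
    with \<omega> show False
      by simp
  qed
  then have "prob {\<omega> \<in> space M. spectral_norm n (poly_kernel_matrix d a b p (\<lambda>i. x i \<omega>)) \<ge> ?thr}
      \<le> prob (\<Union>i<n. E i)"
    using E by (intro finite_measure_mono) auto
  also have "\<dots> \<le> (\<Sum>i<n. prob (E i))"
    using E by (intro finite_measure_subadditive_finite) auto
  also have "\<dots> \<le> (\<Sum>i<n. exp ((2 - (C1 + 3)) * real d))"
    unfolding E_def using psi2 x d assms
    by (intro sum_mono prob_norm_square_ge_le) auto
  also have "\<dots> \<le> exp (C1 * real d) * exp ((2 - (C1 + 3)) * real d)"
    using n_le by (simp add: mult_right_mono)
  also have "\<dots> = exp (- 1 * real d)"
    by (simp add: algebra_simps flip: exp_add)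
  finally show "prob {\<omega> \<in> space M. spectral_norm n (poly_kernel_matrix d a b p (\<lambda>i. x i \<omega>)) \<ge> ?thr}
      \<le> exp (- 1 * real d)" .
qed

end
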